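(* Let $0\leq\lambda\leq 2m$ and $\max\{0,\lambda-m\}\leq\ell\leq \lfloor\lambda/2\rfloor$. Then $$\dim_k S^\lambda_\ell=\binom{2m}{\lambda}-\binom{2m}{\lambda-2\ell-2}.$$
   Context: Let $k=\mathbf F_q$, $q=2^t$, $m\geq1$. Work in the ring $k[X_1,\dots,X_m,Y_1,\dots,Y_m]/(X_i^2,Y_i^2)_i$ of square-free polynomials; $S^\lambda$ is its degree-$\lambda$ part. Put $W_i=X_iY_i$, and let $Z_i$ denote either $X_i$ or $Y_i$. A square-free homogeneous polynomial $F$ is of class $(\rho,\sigma,\tau,\upsilon)$ if there is a partition of $\{1,\dots,m\}$ into disjoint sets $R=\{r_1,\dots,r_\rho\}$, $R'=\{r'_1,\dots,r'_\rho\}$, $S$, $T$, $U$ with $|S|=\sigma,|T|=\tau,|U|=\upsilon$ such that $F=\prod_{i=1}^{\rho}(W_{r_i}+W_{r'_i})\prod_{i\in S}W_i\prod_{i\in T}Z_i$. $P^\lambda_\ell$ is the set of polynomials of classes $(\rho,\sigma,\tau,\upsilon)$ with $2\rho+2\sigma+\tau=\lambda$ and $\sigma\leq\ell$, and $S^\lambda_\ell$ is the $k$-span of $P^\lambda_\ell$. Convention: $\binom{n}{k}=0$ if $k<0$ or $k>n$. *)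

theory Defs
  imports Main "HOL.Vector_Spaces" "HOL-Library.Function_Algebras"
begin

text \<open>Variables: (i, False) is X_i and (i, True) is Y_i.  A square-free monomial is a
  finite set of variables; an element of the square-free ring
  k[X_1..X_m,Y_1..Y_m]/(X_i^2,Y_i^2) is the function assigning to each square-free
  monomial its coefficient (with finite support on monomials in the variables 1..m).\<close>

type_synonym var = "nat \<times> bool"
type_synonym 'k sfpoly = "var set \<Rightarrow> 'k"

definition sf_scale :: "'k::field \<Rightarrow> 'k sfpoly \<Rightarrow> 'k sfpoly" where
  "sf_scale c f = (\<lambda>M. c * f M)"

definition sf_mon :: "var set \<Rightarrow> 'k::field sfpoly" where
  "sf_mon A = (\<lambda>M. if M = A then 1 else 0)"

definition sf_one :: "'k::field sfpoly" where
  "sf_one = sf_mon {}"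

text \<open>Multiplication in the square-free ring: products of monomials sharing a variable vanish.\<close>
definition sf_mult :: "'k::field sfpoly \<Rightarrow> 'k sfpoly \<Rightarrow> 'k sfpoly" where
  "sf_mult f g = (\<lambda>M. \<Sum>A\<in>Pow M. f A * g (M - A))"

definition X :: "nat \<Rightarrow> 'k::field sfpoly" where "X i = sf_mon {(i, False)}"
definition Y :: "nat \<Rightarrow> 'k::field sfpoly" where "Y i = sf_mon {(i, True)}"
definition W :: "nat \<Rightarrow> 'k::field sfpoly" where "W i = sf_mult (X i) (Y i)"
definition Z :: "bool \<Rightarrow> nat \<Rightarrow> 'k::field sfpoly" where "Z b i = (if b then Y i else X i)"

definition sf_prod_list :: "'k::field sfpoly list \<Rightarrow> 'k sfpoly" where
  "sf_prod_list fs = foldr sf_mult fs sf_one"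

definition of_class :: "nat \<Rightarrow> nat \<Rightarrow> nat \<Rightarrow> nat \<Rightarrow> nat \<Rightarrow> 'k::field sfpoly \<Rightarrow> bool" where
  "of_class m \<rho> \<sigma> \<tau> \<upsilon> F \<longleftrightarrow>
     (\<exists>rs S T U (z :: nat \<Rightarrow> bool).
        length rs = \<rho> \<and> distinct (map fst rs @ map snd rs) \<and>
        set (map fst rs) \<union> set (map snd rs) \<union> S \<union> T \<union> U = {1..m} \<and>
        (set (map fst rs) \<union> set (map snd rs)) \<inter> S = {} \<and>
        (set (map fst rs) \<union> set (map snd rs)) \<inter> T = {} \<and>
        (set (map fst rs) \<union> set (map snd rs)) \<inter> U = {} \<and>
        S \<inter> T = {} \<and> S \<inter> U = {} \<and> T \<inter> U = {} \<and>
        card S = \<sigma> \<and> card T = \<tau> \<and> card U = \<upsilon> \<and>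
        F = sf_prod_list (map (\<lambda>(r, r'). W r + W r') rs
                          @ map W (sorted_list_of_set S)
                          @ map (\<lambda>i. Z (z i) i) (sorted_list_of_set T)))"

definition P_set :: "nat \<Rightarrow> nat \<Rightarrow> nat \<Rightarrow> 'k::field sfpoly set" where
  "P_set m lam l = {F. \<exists>\<rho> \<sigma> \<tau> \<upsilon>. of_class m \<rho> \<sigma> \<tau> \<upsilon> F \<and>
                      2 * \<rho> + 2 * \<sigma> + \<tau> = lam \<and> \<sigma> \<le> l}"

definition S_space :: "nat \<Rightarrow> nat \<Rightarrow> nat \<Rightarrow> 'k::field sfpoly set" where
  "S_space m lam l = module.span sf_scale (P_set m lam l)"

definition sf_dim :: "'k::field sfpoly set \<Rightarrow> nat" where
  "sf_dim V = vector_space.dim sf_scale V"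

definition binomz :: "nat \<Rightarrow> int \<Rightarrow> int" where
  "binomz n k = (if k < 0 then 0 else int (n choose nat k))"

end

theory Submission
  imports Defs
begin

text \<open>
  Fix \<open>l\<close> and call a monomial in the variables with indices \<open>1, \<dots>, n\<close> \<^emph>\<open>overfull\<close> if for some \<open>j \<le> n\<close>
  it contains more than \<open>j + l\<close> variables with index at most \<open>j\<close>. In degree \<open>k \<le> n + l + 1\<close> the overfull
  monomials span a complement of the span of \<open>P_set n k l\<close>, and as in the reflection principle
  their number is \<open>binomz (2 * n) (k - 2 * l - 2)\<close>. Everything is by induction on \<open>n\<close>, removing the last index.

  The two spaces together span all monomials of degree \<open>k\<close>, because
  \<open>W\<^sub>n G = (W\<^sub>r + W\<^sub>n) G - W\<^sub>r G\<close> for an index \<open>r\<close> not occurring in \<open>G\<close>; if there is no such \<open>r\<close>,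
  the degree bound forces \<open>\<sigma> < l\<close> for \<open>G\<close>, so that \<open>W\<^sub>n G\<close> is itself in \<open>P_set\<close>.

  They meet only in 0, because of the functionals \<open>pairing n N\<close>, one for each monomial \<open>N\<close>. Those
  with \<open>N\<close> of degree at most \<open>k - 2 * l - 2\<close> separate the combinations of overfull monomials, but vanish
  on \<open>P_set\<close>: such an \<open>N\<close> has too few variables to meet all pairs \<open>{r, r'}\<close> and all factors \<open>Z\<^sub>i\<close>, and a
  factor \<open>W\<^sub>r + W\<^sub>r'\<close> with both indices absent from \<open>N\<close> contributes \<open>1 + 1 = 0\<close>.
\<close>

section \<open>Complements and dimension\<close>

context vector_space
begin

text \<open>If \<open>c\<close> lay in the span of \<open>B \<union> C\<close>, say
  \<open>c = x + y\<close>, then \<open>x = c - y\<close> would lie in the spans of \<open>B\<close>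
  and of \<open>insert c C\<close>, hence vanish and put \<open>c\<close> into the span of
  \<open>C\<close>.\<close>

lemma independent_Un_span_disjoint:
  assumes "independent B" "independent C" "finite C" "span B \<inter> span C \<subseteq> {0}"
  shows "independent (B \<union> C)"
  using assms(3,2,4)
proof (induction C)
  case empty
  then show ?case using assms(1) by simp
next
  case (insert c C)
  have c: "c \<notin> span C" "independent C"
    using insert.prems(1) insert.hyps by (auto simp: independent_insert)
  have sub: "span C \<subseteq> span (insert c C)"
    by (rule span_mono) auto
  have "independent (B \<union> C)"
    using insert.IH c(2) insert.prems(2) sub by blast
  moreover have "c \<notin> span (B \<union> C)"
  proof
    assume "c \<in> span (B \<union> C)"
    then obtain x y where xy: "c = x + y" "x \<in> span B" "y \<in> span C"
      unfolding span_Un by blast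
    have "c - y \<in> span (insert c C)"
      using xy(3) sub by (intro span_diff) (auto intro: span_base)
    then have "c - y = 0"
      using xy insert.prems(2) by auto
    then show False using c xy by simp
  qed
  ultimately show ?case
    by (simp add: independent_insertI)
qed

text \<open>Reduces a dimension to counting: a basis chosen inside \<open>V\<close>, together with
  \<open>C\<close>, is a basis of the span of \<open>D\<close>. Here \<open>V\<close> may be any
  generating set, not only a subspace.\<close>

lemma dim_complement:
  assumes "finite D" "independent D" "C \<subseteq> D" "V \<subseteq> span D"
    and "span V \<inter> span C \<subseteq> {0}" "D \<subseteq> span (V \<union> C)"
  shows "dim V + card C = card D"
proof -
  obtain B where B: "B \<subseteq> V" "independent B" "V \<subseteq> span B" "card B = dim V"
    using basis_exists by blast
  have spB: "span B = span V"
    using B by (metis span_eq span_superset subset_trans)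
  have C: "finite C" "independent C"
    using assms(1-3) by (auto intro: finite_subset dest: dependent_mono)
  have BD: "B \<subseteq> span D" using B assms(4) by blast
  have fB: "finite B"
    using independent_span_bound[OF assms(1) B(2) BD] by simp
  have "B \<inter> C = {}"
  proof -
    have "x \<in> B \<Longrightarrow> x \<in> C \<Longrightarrow> x = 0" for x
      using assms(5) spB by (metis IntI in_mono singletonD span_base)
    then show ?thesis using B(2) dependent_zero by blast
  qed
  have ind: "independent (B \<union> C)"
    using independent_Un_span_disjoint B C assms(5) spB by auto
  have "span (B \<union> C) = span D"
  proof
    show "span (B \<union> C) \<subseteq> span D"
      using BD assms(3) by (intro span_minimal) (auto intro: span_base)
    have "V \<union> C \<subseteq> span (B \<union> C)"
      using B(3) span_mono[of B "B \<union> C"] span_superset[of "B \<union> C"] by blast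
    then have "span (V \<union> C) \<subseteq> span (B \<union> C)"
      by (intro span_minimal) auto
    then show "span D \<subseteq> span (B \<union> C)"
      using assms(6) by (intro span_minimal) auto
  qed
  then have "card (B \<union> C) = card D"
    using ind assms(2) by (metis dim_eq_card_independent dim_span)
  then show ?thesis
    using \<open>B \<inter> C = {}\<close> fB C B(4) by (simp add: card_Un_disjoint)
qed

end

section \<open>Overfull monomials\<close>

definition vars :: "nat \<Rightarrow> var set" where
  "vars n = {1..n} \<times> UNIV"

text \<open>As a monomial this is \<open>W i\<close>; the slice \<open>M \<inter> varpair i\<close>
  is the part of \<open>M\<close> with index \<open>i\<close>.\<close>

definition varpair :: "nat \<Rightarrow> var set" where
  "varpair i = {i} \<times> UNIV"

lemma finite_vars [simp]: "finite (vars n)"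
  by (simp add: vars_def)

lemma finite_varpair [simp]: "finite (varpair i)"
  by (simp add: varpair_def)

lemma card_vars: "card (vars n) = 2 * n"
  by (simp add: vars_def card_cartesian_product)

lemma card_varpair [simp]: "card (varpair i) = 2"
  by (simp add: varpair_def card_cartesian_product)

lemma varpair_nonempty [simp]: "varpair i \<noteq> {}" "{} \<noteq> varpair i"
  by (auto simp: varpair_def)

lemma varpair_disjoint: "i \<noteq> j \<Longrightarrow> varpair i \<inter> varpair j = {}"
  by (auto simp: varpair_def)

lemma vars_0 [simp]: "vars 0 = {}"
  by (simp add: vars_def)

lemma vars_Suc: "vars (Suc n) = vars n \<union> varpair (Suc n)"
  by (auto simp: vars_def varpair_def)

lemma vars_disjoint_varpair: "vars n \<inter> varpair (Suc n) = {}"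
  by (auto simp: vars_def varpair_def)

lemma Pow_varpair: "Pow (varpair i) = {{}, {(i, False)}, {(i, True)}, varpair i}"
proof -
  have "varpair i = {(i, False), (i, True)}"
    by (auto simp: varpair_def UNIV_bool)
  then show ?thesis by (auto simp: Pow_insert)
qed

lemma varpair_neq_singleton: "varpair i \<noteq> {(i, b)}" "{(i, b)} \<noteq> varpair i"
  by (auto simp: varpair_def)

lemma sum_Pow_varpair:
  "(\<Sum>D\<in>Pow (varpair i). h D)
     = h {} + h {(i, False)} + h {(i, True)} + (h (varpair i) :: 'a::comm_monoid_add)"
  by (simp add: Pow_varpair varpair_neq_singleton add.assoc)

lemma union_Int_parts:
  assumes "N \<subseteq> vars n" "D \<subseteq> varpair (Suc n)"
  shows "(N \<union> D) \<inter> vars n = N" "(N \<union> D) \<inter> varpair (Suc n) = D"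
  using assms vars_disjoint_varpair[of n] by blast+

lemma card_union_parts:
  assumes "N \<subseteq> vars n" "D \<subseteq> varpair (Suc n)"
  shows "card (N \<union> D) = card N + card D"
  using assms vars_disjoint_varpair[of n]
  by (intro card_Un_disjoint) (auto intro: finite_subset)

lemma subset_vars_Suc_E:
  assumes "M \<subseteq> vars (Suc n)"
  obtains N D where "M = N \<union> D" "N \<subseteq> vars n" "D \<subseteq> varpair (Suc n)"
proof
  show "M = (M \<inter> vars n) \<union> (M \<inter> varpair (Suc n))" using assms vars_Suc by auto
qed auto

lemma bij_betw_union_parts:
  "bij_betw (\<lambda>(D, N). N \<union> D) (Pow (varpair (Suc n)) \<times> Pow (vars n)) (Pow (vars (Suc n)))"
  by (rule bij_betw_byWitness[where f' = "\<lambda>M. (M \<inter> varpair (Suc n), M \<inter> vars n)"])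
     (use vars_disjoint_varpair[of n] in \<open>auto simp: vars_Suc\<close>)

lemma sum_Pow_vars_Suc:
  "(\<Sum>M\<in>Pow (vars (Suc n)). h M)
     = (\<Sum>D\<in>Pow (varpair (Suc n)). \<Sum>N\<in>Pow (vars n). h (N \<union> D))"
  by (simp add: sum.reindex_bij_betw[OF bij_betw_union_parts, symmetric] sum.cartesian_product
      case_prod_unfold)

text \<open>Read \<open>card (M \<inter> varpair i) - 1\<close> as the i-th step of a walk with
  steps -1, 0, 1. Overfull then means that the walk rises above height \<open>l\<close>, the event
  to which reflection applies.\<close>

definition overfull :: "nat \<Rightarrow> nat \<Rightarrow> var set \<Rightarrow> bool" where
  "overfull l n M \<longleftrightarrow> (\<exists>j\<le>n. j + l < card (M \<inter> vars j))"

text \<open>The only new condition is the one at \<open>j = Suc n\<close>, and the degree bound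
  rules it out.\<close>

lemma overfull_Suc:
  assumes "N \<subseteq> vars n" "D \<subseteq> varpair (Suc n)" "card N + card D \<le> Suc n + l"
  shows "overfull l (Suc n) (N \<union> D) \<longleftrightarrow> overfull l n N"
proof -
  have "(N \<union> D) \<inter> vars j = N \<inter> vars j" if "j \<le> n" for j
    using that assms by (auto simp: vars_def varpair_def)
  moreover have "(N \<union> D) \<inter> vars (Suc n) = N \<union> D"
    using assms by (auto simp: vars_Suc)
  ultimately show ?thesis
    using assms card_union_parts[OF assms(1,2)] by (auto simp: overfull_def le_Suc_eq)
qed

lemma overfull_if_card: "M \<subseteq> vars n \<Longrightarrow> n + l < card M \<Longrightarrow> overfull l n M"
  unfolding overfull_def by (intro exI[of _ n]) (simp add: Int_absorb2)

section \<open>Binomial identities and the number of overfull monomials\<close>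

lemma binomz_Suc_Suc:
  "binomz (2 * Suc n) k = binomz (2 * n) k + 2 * binomz (2 * n) (k - 1) + binomz (2 * n) (k - 2)"
proof -
  consider "k < 0" | "k = 0" | "k = 1" | "k \<ge> 2" by linarith
  then show ?thesis
  proof cases
    case 4
    then obtain j where j: "k = int (Suc (Suc j))"
      by (metis Suc_1 add_2_eq_Suc int_nat_eq le_Suc_ex nat_2 nat_mono nat_numeral_as_int
          order_trans zero_le_numeral)
    have "nat (k - 1) = Suc j" "nat (k - 2) = j" "nat k = Suc (Suc j)" using j by auto
    then show ?thesis using 4 by (simp add: binomz_def)
  qed (auto simp: binomz_def)
qed

lemma binomz_symmetric: "binomz n (int n - k) = binomz n k"
proof (cases "0 \<le> k \<and> k \<le> int n")
  case True
  then obtain j where "k = int j" "j \<le> n"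
    by (metis nat_0_le nat_le_iff)
  then show ?thesis
    by (simp add: binomz_def nat_diff_distrib binomial_symmetric[of j n, symmetric])
next
  case False
  then show ?thesis by (auto simp: binomz_def)
qed

lemma card_subsets_vars: "int (card {M. M \<subseteq> vars n \<and> int (card M) = k}) = binomz (2 * n) k"
proof (cases "k < 0")
  case False
  then have "{M. M \<subseteq> vars n \<and> int (card M) = k} = {M. M \<subseteq> vars n \<and> card M = nat k}"
    by auto
  then show ?thesis using False by (simp add: n_subsets binomz_def card_vars)
qed (auto simp: binomz_def)

text \<open>Both sides satisfy the same recursion in \<open>n\<close>, with weights 1, 2, 1 for the
  subsets of the last index by size; on the boundary \<open>k = n + l + 1\<close> the symmetry of
  the binomials gives the value. The degree is an integer because removing the last index may make
  it negative.\<close>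

lemma card_overfull:
  assumes "k \<le> int n + int l + 1"
  shows "int (card {M. M \<subseteq> vars n \<and> int (card M) = k \<and> overfull l n M})
           = binomz (2 * n) (k - 2 * int l - 2)"
  using assms
proof (induction n arbitrary: k)
  case 0
  then show ?case by (auto simp: overfull_def binomz_def)
next
  case (Suc n)
  let ?O = "\<lambda>n k. {M. M \<subseteq> vars n \<and> int (card M) = k \<and> overfull l n M}"
  show ?case
  \<comment> \<open>On the boundary every monomial is overfull, and \<open>2 * Suc n - k\<close>
    equals \<open>k - 2 * l - 2\<close>.\<close>
  proof (cases "k = int (Suc n) + int l + 1")
    case True
    then have "?O (Suc n) k = {M. M \<subseteq> vars (Suc n) \<and> int (card M) = k}"
      by (auto intro: overfull_if_card)
    then have "int (card (?O (Suc n) k)) = binomz (2 * Suc n) k"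
      by (simp only: card_subsets_vars)
    also have "\<dots> = binomz (2 * Suc n) (k - 2 * int l - 2)"
      using True binomz_symmetric[of "2 * Suc n" k] by (simp add: algebra_simps)
    finally show ?thesis .
  next
    case False
    then have le: "k \<le> int (Suc n) + int l" using Suc.prems by simp
    \<comment> \<open>Below the boundary the slice \<open>D\<close> at the last index does not
      affect overfullness, and the remaining degree is at most \<open>n + l + 1\<close>, as the
      induction hypothesis requires.\<close>
    let ?A = "\<lambda>D. (\<lambda>N. N \<union> D) ` ?O n (k - int (card D))"
    have eq: "?O (Suc n) k = (\<Union>D\<in>Pow (varpair (Suc n)). ?A D)" (is "_ = ?R")
    proof (intro equalityI subsetI)
      fix M assume M: "M \<in> ?O (Suc n) k"
      then obtain N D where ND: "M = N \<union> D" "N \<subseteq> vars n" "D \<subseteq> varpair (Suc n)"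
        using subset_vars_Suc_E by blast
      have "N \<in> ?O n (k - int (card D))"
        using M ND le card_union_parts[OF ND(2,3)] overfull_Suc[OF ND(2,3), of l] by auto
      then show "M \<in> ?R" using ND by blast
    next
      fix M assume "M \<in> ?R"
      then obtain N D where ND: "M = N \<union> D" "D \<subseteq> varpair (Suc n)" "N \<in> ?O n (k - int (card D))"
        by blast
      then have N: "N \<subseteq> vars n" by simp
      show "M \<in> ?O (Suc n) k"
        using N ND le card_union_parts[OF N ND(2)] overfull_Suc[OF N ND(2), of l]
        by (auto simp: vars_Suc)
    qed
    have inj: "inj_on (\<lambda>N. N \<union> D) (?O n j)" if "D \<subseteq> varpair (Suc n)" for D j
      using that by (intro inj_on_inverseI[where g = "\<lambda>M. M \<inter> vars n"]) (simp add: union_Int_parts)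
    have "card (?O (Suc n) k) = (\<Sum>D\<in>Pow (varpair (Suc n)). card (?A D))"
      unfolding eq
    proof (rule card_UN_disjoint, goal_cases)
      case 3
      show ?case
      proof (intro ballI impI equals0I)
        fix D D' M assume D: "D \<in> Pow (varpair (Suc n))" "D' \<in> Pow (varpair (Suc n))" "D \<noteq> D'"
          and M: "M \<in> ?A D \<inter> ?A D'"
        then obtain N N' where "M = N \<union> D" "N \<subseteq> vars n" "M = N' \<union> D'" "N' \<subseteq> vars n"
          by blast
        then have "M \<inter> varpair (Suc n) = D" "M \<inter> varpair (Suc n) = D'"
          using D union_Int_parts(2)[of N n D] union_Int_parts(2)[of N' n D'] by auto
        then show False using D by simp
      qed
    qed auto
    also have "\<dots> = (\<Sum>D\<in>Pow (varpair (Suc n)). card (?O n (k - int (card D))))"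
      by (intro sum.cong refl card_image inj) auto
    also have "int \<dots> = binomz (2 * n) (k - 2 * int l - 2) + 2 * binomz (2 * n) (k - 1 - 2 * int l - 2)
        + binomz (2 * n) (k - 2 - 2 * int l - 2)"
      using le by (simp add: sum_Pow_varpair Suc.IH)
    finally show ?thesis
      unfolding binomz_Suc_Suc by (simp add: algebra_simps)
  qed
qed

section \<open>Monomials of the generators\<close>

text \<open>A generator has only the coefficients 0 and 1, so it is encoded by its set of monomials,
  and products become operations on sets.\<close>

definition ind :: "var set set \<Rightarrow> 'k::field sfpoly" where
  "ind \<A> = (\<lambda>M. if M \<in> \<A> then 1 else 0)"

lemma sf_mon_eq_ind: "sf_mon A = ind {A}"
  by (auto simp: sf_mon_def ind_def)

lemma ind_Un_disjoint: "\<A> \<inter> \<B> = {} \<Longrightarrow> ind (\<A> \<union> \<B>) = ind \<A> + ind \<B>"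
  by (auto simp: ind_def fun_eq_iff)

text \<open>The sum over \<open>Pow M\<close> defaults to 0 when \<open>M\<close> is infinite, hence
  the finiteness test.\<close>

lemma sf_mult_sf_mon:
  "sf_mult (sf_mon A) f M = (if finite M \<and> A \<subseteq> M then f (M - A) else 0)"
proof (cases "finite M")
  case True
  have "sf_mult (sf_mon A) f M = (\<Sum>B\<in>Pow M. if B = A then f (M - B) else 0)"
    unfolding sf_mult_def sf_mon_def by (intro sum.cong) auto
  then show ?thesis using True by simp
qed (simp add: sf_mult_def)

text \<open>Disjointness keeps every product nonzero and makes adjoining \<open>A\<close> injective
  on \<open>\<A>\<close>, so no coefficient other than 0 and 1 arises.\<close>

lemma sf_mult_sf_mon_ind:
  assumes "finite A" "\<And>N. N \<in> \<A> \<Longrightarrow> finite N \<and> A \<inter> N = {}"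
  shows "sf_mult (sf_mon A) (ind \<A>) = ind ((\<union>) A ` \<A>)"
proof
  fix M
  have "finite M \<and> A \<subseteq> M \<and> M - A \<in> \<A> \<longleftrightarrow> M \<in> (\<union>) A ` \<A>"
  proof
    assume "finite M \<and> A \<subseteq> M \<and> M - A \<in> \<A>"
    then show "M \<in> (\<union>) A ` \<A>" by (intro image_eqI[of _ _ "M - A"]) auto
  next
    assume "M \<in> (\<union>) A ` \<A>"
    then obtain N where N: "M = A \<union> N" "N \<in> \<A>" by blast
    then have "M - A = N" using assms(2) by blast
    then show "finite M \<and> A \<subseteq> M \<and> M - A \<in> \<A>" using N assms by auto
  qed
  then show "sf_mult (sf_mon A) (ind \<A>) M = ind ((\<union>) A ` \<A>) M"
    unfolding sf_mult_sf_mon ind_def by auto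
qed

lemma sf_mult_add_left: "sf_mult (f + g) h = sf_mult f h + sf_mult g h"
  by (simp add: sf_mult_def fun_eq_iff distrib_right sum.distrib)

lemma W_eq: "W i = sf_mon (varpair i)"
proof -
  have "varpair i = {(i, False)} \<union> {(i, True)}"
    by (auto simp: varpair_def)
  then show ?thesis
    using sf_mult_sf_mon_ind[of "{(i, False)}" "{{(i, True)}}"]
    by (simp add: W_def X_def Y_def flip: sf_mon_eq_ind)
qed

lemma Z_eq: "Z b i = sf_mon {(i, b)}"
  by (simp add: Z_def X_def Y_def)

section \<open>The monomials of a product, factor by factor\<close>

definition indices :: "(nat \<times> nat) list \<Rightarrow> nat set \<Rightarrow> nat set \<Rightarrow> nat set" where
  "indices rs S T = fst ` set rs \<union> snd ` set rs \<union> S \<union> T"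

text \<open>Conditions are imposed slice by slice, so that a new factor constrains only the slices
  at its own indices.\<close>

definition matches :: "(nat \<times> nat) list \<Rightarrow> nat set \<Rightarrow> nat set \<Rightarrow> (nat \<Rightarrow> bool) \<Rightarrow> var set \<Rightarrow> bool"
  where "matches rs S T z M \<longleftrightarrow>
     (\<forall>i\<in>S. M \<inter> varpair i = varpair i) \<and>
     (\<forall>i\<in>T. M \<inter> varpair i = {(i, z i)}) \<and>
     (\<forall>(r, r')\<in>set rs. (M \<inter> varpair r = varpair r \<and> M \<inter> varpair r' = {}) \<or>
                         (M \<inter> varpair r = {} \<and> M \<inter> varpair r' = varpair r'))"

text \<open>The monomials of the polynomial of class \<open>(\<rho>, \<sigma>, \<tau>, \<upsilon>)\<close> given by \<open>rs\<close>, \<open>S\<close>, \<open>T\<close>, \<open>z\<close>; all of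
  them have coefficient 1.\<close>

definition fam :: "(nat \<times> nat) list \<Rightarrow> nat set \<Rightarrow> nat set \<Rightarrow> (nat \<Rightarrow> bool) \<Rightarrow> var set set" where
  "fam rs S T z = {M. M \<subseteq> indices rs S T \<times> UNIV \<and> matches rs S T z M}"

lemma indices_simps [simp]:
  "indices [] {} {} = {}"
  "indices ((r, r') # rs) S T = {r, r'} \<union> indices rs S T"
  "indices rs (insert i S) T = insert i (indices rs S T)"
  "indices rs S (insert i T) = insert i (indices rs S T)"
  by (auto simp: indices_def)

lemma finite_indices: "finite S \<Longrightarrow> finite T \<Longrightarrow> finite (indices rs S T)"
  by (simp add: indices_def)

lemma finite_fam_member: "M \<in> fam rs S T z \<Longrightarrow> finite S \<Longrightarrow> finite T \<Longrightarrow> finite M"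
  by (rule finite_subset[of _ "indices rs S T \<times> UNIV"]) (auto simp: fam_def finite_indices)

lemma fam_Int_varpair: "M \<in> fam rs S T z \<Longrightarrow> i \<notin> indices rs S T \<Longrightarrow> M \<inter> varpair i = {}"
  by (auto simp: fam_def varpair_def)

lemma matches_cong:
  assumes "\<And>i. i \<in> indices rs S T \<Longrightarrow> M \<inter> varpair i = M' \<inter> varpair i"
  shows "matches rs S T z M \<longleftrightarrow> matches rs S T z M'"
proof -
  have "M \<inter> varpair i = M' \<inter> varpair i" if "i \<in> S \<or> i \<in> T" for i
    using that assms by (auto simp: indices_def)
  moreover have "M \<inter> varpair (fst p) = M' \<inter> varpair (fst p)"
    "M \<inter> varpair (snd p) = M' \<inter> varpair (snd p)" if "p \<in> set rs" for p
    using that by (intro assms; simp add: indices_def)+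
  ultimately show ?thesis
    unfolding matches_def case_prod_unfold by (simp cong: ball_cong)
qed

lemma fam_empty [simp]: "fam [] {} {} z = {{}}"
  by (auto simp: fam_def matches_def)

text \<open>Common pattern for the three kinds of factor: \<open>J\<close> holds the indices of the
  new factor and \<open>\<D>\<close> its monomials, and \<open>M\<close> is recovered from its parts
  over \<open>J\<close> and over the old indices.\<close>

lemma fam_extend:
  assumes "indices rs' S' T' = J \<union> indices rs S T" "J \<inter> indices rs S T = {}"
    and "\<And>D. D \<in> \<D> \<Longrightarrow> D \<subseteq> J \<times> UNIV"
    and "\<And>M. matches rs' S' T' z M \<longleftrightarrow> M \<inter> J \<times> UNIV \<in> \<D> \<and> matches rs S T z M"
  shows "fam rs' S' T' z = (\<Union>D\<in>\<D>. (\<union>) D ` fam rs S T z)"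
proof (intro equalityI subsetI)
  fix M assume M: "M \<in> fam rs' S' T' z"
  let ?N = "M \<inter> indices rs S T \<times> UNIV"
  have "matches rs S T z ?N \<longleftrightarrow> matches rs S T z M"
    by (rule matches_cong) (auto simp: varpair_def)
  then have "?N \<in> fam rs S T z"
    using M assms(4) by (auto simp: fam_def)
  moreover have "M = (M \<inter> J \<times> UNIV) \<union> ?N" "M \<inter> J \<times> UNIV \<in> \<D>"
    using M assms(1,4) by (auto simp: fam_def)
  ultimately show "M \<in> (\<Union>D\<in>\<D>. (\<union>) D ` fam rs S T z)" by blast
next
  fix M assume "M \<in> (\<Union>D\<in>\<D>. (\<union>) D ` fam rs S T z)"
  then obtain D N where M: "D \<in> \<D>" "M = D \<union> N" "N \<in> fam rs S T z" by blast
  have D: "D \<subseteq> J \<times> UNIV" using M(1) assms(3) by simp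
  have "matches rs S T z M \<longleftrightarrow> matches rs S T z N"
    using D assms(2) M(2) by (intro matches_cong) (auto simp: varpair_def)
  moreover have "M \<inter> J \<times> UNIV = D"
    using D assms(2) M(2,3) by (auto simp: fam_def)
  ultimately show "M \<in> fam rs' S' T' z"
    using M D assms(1,4) by (auto simp: fam_def)
qed

lemma fam_insert_S:
  assumes "i \<notin> indices rs S T"
  shows "fam rs (insert i S) T z = (\<union>) (varpair i) ` fam rs S T z"
proof -
  have "fam rs (insert i S) T z = (\<Union>D\<in>{varpair i}. (\<union>) D ` fam rs S T z)"
    by (rule fam_extend[where J = "{i}"]) (use assms in \<open>auto simp: varpair_def matches_def\<close>)
  then show ?thesis by simp
qed

lemma fam_insert_T:
  assumes "i \<notin> indices rs S T"
  shows "fam rs S (insert i T) z = (\<union>) {(i, z i)} ` fam rs S T z"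
proof -
  have "fam rs S (insert i T) z = (\<Union>D\<in>{{(i, z i)}}. (\<union>) D ` fam rs S T z)"
    by (rule fam_extend[where J = "{i}"]) (use assms in \<open>auto simp: varpair_def matches_def\<close>)
  then show ?thesis by simp
qed

lemma fam_Cons:
  assumes "r \<noteq> r'" "r \<notin> indices rs S T" "r' \<notin> indices rs S T"
  shows "fam ((r, r') # rs) S T z
    = (\<union>) (varpair r) ` fam rs S T z \<union> (\<union>) (varpair r') ` fam rs S T z"
proof -
  have "(M \<inter> varpair r = varpair r \<and> M \<inter> varpair r' = {} \<or>
         M \<inter> varpair r = {} \<and> M \<inter> varpair r' = varpair r')
       \<longleftrightarrow> M \<inter> {r, r'} \<times> UNIV \<in> {varpair r, varpair r'}" for M
  proof -
    have "{r, r'} \<times> UNIV = varpair r \<union> varpair r'" by (auto simp: varpair_def)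
    then show ?thesis
      using varpair_disjoint[OF assms(1)] varpair_nonempty[of r] varpair_nonempty[of r']
      by (auto simp: Int_Un_distrib)
  qed
  then have "fam ((r, r') # rs) S T z = (\<Union>D\<in>{varpair r, varpair r'}. (\<union>) D ` fam rs S T z)"
    by (intro fam_extend[where J = "{r, r'}"]) (use assms in \<open>auto simp: varpair_def matches_def\<close>)
  then show ?thesis by simp
qed

lemma sf_mult_sf_mon_fam:
  assumes "finite S" "finite T" "i \<notin> indices rs S T" "D \<subseteq> varpair i"
  shows "sf_mult (sf_mon D) (ind (fam rs S T z)) = ind ((\<union>) D ` fam rs S T z)"
proof (rule sf_mult_sf_mon_ind)
  fix N assume "N \<in> fam rs S T z"
  then show "finite N \<and> D \<inter> N = {}"
    using assms finite_fam_member by (auto simp: fam_def varpair_def)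
qed (use assms finite_subset finite_varpair in blast)

text \<open>The product list is folded from the right, so the factors Z are accumulated first, then
  the factors W, then the sums of two W.\<close>

lemma foldr_Z_fam:
  "distinct ts \<Longrightarrow> foldr sf_mult (map (\<lambda>i. Z (z i) i) ts) sf_one = ind (fam [] {} (set ts) z)"
proof (induction ts)
  case Nil
  then show ?case by (simp add: sf_one_def sf_mon_eq_ind)
next
  case (Cons i ts)
  then have i: "i \<notin> indices [] {} (set ts)" by (simp add: indices_def)
  show ?case
    using Cons i by (simp add: Z_eq fam_insert_T sf_mult_sf_mon_fam[where i = i] varpair_def)
qed

lemma foldr_W_fam:
  "distinct ss \<Longrightarrow> set ss \<inter> T = {} \<Longrightarrow> finite T \<Longrightarrow>
    foldr sf_mult (map W ss) (ind (fam [] {} T z)) = ind (fam [] (set ss) T z)"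
proof (induction ss)
  case (Cons i ss)
  then have i: "i \<notin> indices [] (set ss) T" by (simp add: indices_def)
  show ?case
    using Cons i by (simp add: W_eq fam_insert_S sf_mult_sf_mon_fam[where i = i])
qed simp

lemma foldr_W_pair_fam:
  assumes "finite S" "finite T"
  shows "distinct (map fst rs @ map snd rs) \<Longrightarrow> (fst ` set rs \<union> snd ` set rs) \<inter> (S \<union> T) = {} \<Longrightarrow>
    foldr sf_mult (map (\<lambda>(r, r'). W r + W r') rs) (ind (fam [] S T z)) = (ind (fam rs S T z) :: 'k::field sfpoly)"
    (is "_ \<Longrightarrow> _ \<Longrightarrow> _ = ?F rs")
proof (induction rs)
  case (Cons p rs)
  obtain r r' where p: "p = (r, r')" by fastforce
  have r: "r \<noteq> r'" "r \<notin> indices rs S T" "r' \<notin> indices rs S T"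
    using Cons.prems by (auto simp: p indices_def)
  \<comment> \<open>The monomials of the first image contain \<open>varpair r\<close> and those of
    the second avoid it, so no coefficient becomes 2.\<close>
  have "?F (p # rs) = ind ((\<union>) (varpair r) ` fam rs S T z) + ind ((\<union>) (varpair r') ` fam rs S T z)"
    unfolding p fam_Cons[OF r]
    by (rule ind_Un_disjoint) (use r in \<open>auto simp: fam_def varpair_def\<close>)
  also have "\<dots> = sf_mult (W r + W r') (?F rs)"
    unfolding sf_mult_add_left W_eq sf_mult_sf_mon_fam[OF assms r(2) order_refl]
      sf_mult_sf_mon_fam[OF assms r(3) order_refl] ..
  finally have "?F (p # rs) = sf_mult (W r + W r') (?F rs)" .
  moreover have "foldr sf_mult (map (\<lambda>(r, r'). W r + W r') rs) (ind (fam [] S T z)) = ?F rs"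
    using Cons.prems by (intro Cons.IH) auto
  ultimately show ?case
    by (simp only: p list.map foldr.simps o_apply prod.case)
qed simp

section \<open>Index data of a class, and degree counts\<close>

definition class_data :: "nat \<Rightarrow> (nat \<times> nat) list \<Rightarrow> nat set \<Rightarrow> nat set \<Rightarrow> nat set \<Rightarrow> bool" where
  "class_data m rs S T U \<longleftrightarrow>
     distinct (map fst rs @ map snd rs) \<and> indices rs S T \<union> U = {1..m} \<and> indices rs S T \<inter> U = {} \<and>
     (fst ` set rs \<union> snd ` set rs) \<inter> (S \<union> T) = {} \<and> S \<inter> T = {}"

lemma class_dataD:
  assumes "class_data m rs S T U"
  shows "finite S" "finite T" "finite U"
  using assms finite_subset[of _ "{1..m}"] by (auto simp: class_data_def indices_def)

lemma prod_eq_ind_fam: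
  assumes "class_data m rs S T U"
  shows "sf_prod_list (map (\<lambda>(r, r'). W r + W r') rs @ map W (sorted_list_of_set S)
           @ map (\<lambda>i. Z (z i) i) (sorted_list_of_set T)) = ind (fam rs S T z)"
proof -
  note fin = class_dataD[OF assms]
  have "distinct (map fst rs @ map snd rs)" "(fst ` set rs \<union> snd ` set rs) \<inter> (S \<union> T) = {}" "S \<inter> T = {}"
    using assms by (auto simp: class_data_def)
  then show ?thesis
    using fin by (simp add: sf_prod_list_def foldr_Z_fam foldr_W_fam foldr_W_pair_fam del: foldr_map)
qed

text \<open>From here on generators are given by combinatorial data. \<open>U\<close> stays visible
  because the spanning argument draws the partner of a new index from it.\<close>

lemma mem_P_set_iff:
  "F \<in> P_set m lam l \<longleftrightarrow> (\<exists>rs S T U z. class_data m rs S T U \<and>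
     2 * length rs + 2 * card S + card T = lam \<and> card S \<le> l \<and> F = ind (fam rs S T z))"
proof -
  have "length rs = \<rho> \<and> distinct (map fst rs @ map snd rs) \<and>
        set (map fst rs) \<union> set (map snd rs) \<union> S \<union> T \<union> U = {1..m} \<and>
        (set (map fst rs) \<union> set (map snd rs)) \<inter> S = {} \<and>
        (set (map fst rs) \<union> set (map snd rs)) \<inter> T = {} \<and>
        (set (map fst rs) \<union> set (map snd rs)) \<inter> U = {} \<and>
        S \<inter> T = {} \<and> S \<inter> U = {} \<and> T \<inter> U = {} \<and>
        card S = \<sigma> \<and> card T = \<tau> \<and> card U = \<upsilon> \<and>
        F = sf_prod_list (map (\<lambda>(r, r'). W r + W r') rs
                          @ map W (sorted_list_of_set S)
                          @ map (\<lambda>i. Z (z i) i) (sorted_list_of_set T))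
     \<longleftrightarrow> length rs = \<rho> \<and> class_data m rs S T U \<and>
        card S = \<sigma> \<and> card T = \<tau> \<and> card U = \<upsilon> \<and> F = ind (fam rs S T z)"
    (is "?L \<longleftrightarrow> ?R") for rs S T U z \<rho> \<sigma> \<tau> \<upsilon>
  proof -
    have "?L \<longleftrightarrow> length rs = \<rho> \<and> class_data m rs S T U \<and> card S = \<sigma> \<and> card T = \<tau> \<and> card U = \<upsilon> \<and>
        F = sf_prod_list (map (\<lambda>(r, r'). W r + W r') rs
                          @ map W (sorted_list_of_set S)
                          @ map (\<lambda>i. Z (z i) i) (sorted_list_of_set T))"
      unfolding class_data_def indices_def set_map Int_Un_distrib Int_Un_distrib2 Un_empty
      by (intro iffI; elim conjE; intro conjI; assumption)
    also have "\<dots> \<longleftrightarrow> ?R"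
    proof (cases "class_data m rs S T U")
      case True
      then show ?thesis by (simp only: prod_eq_ind_fam[OF True])
    qed (simp only: simp_thms)
    finally show ?thesis .
  qed
  then have "F \<in> P_set m lam l \<longleftrightarrow> (\<exists>\<rho> \<sigma> \<tau> \<upsilon>. (\<exists>rs S T U z. length rs = \<rho> \<and> class_data m rs S T U \<and>
        card S = \<sigma> \<and> card T = \<tau> \<and> card U = \<upsilon> \<and> F = ind (fam rs S T z)) \<and>
        2 * \<rho> + 2 * \<sigma> + \<tau> = lam \<and> \<sigma> \<le> l)"
    unfolding P_set_def of_class_def mem_Collect_eq by (simp only:)
  also have "\<dots> \<longleftrightarrow> (\<exists>rs S T U z. class_data m rs S T U \<and>
     2 * length rs + 2 * card S + card T = lam \<and> card S \<le> l \<and> F = ind (fam rs S T z))"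
    by blast
  finally show ?thesis .
qed

lemma card_eq_sum_slices:
  assumes "finite I" "M \<subseteq> I \<times> UNIV"
  shows "card M = (\<Sum>i\<in>I. card (M \<inter> varpair i))"
proof -
  have "M = (\<Union>i\<in>I. M \<inter> varpair i)"
    using assms by (auto simp: varpair_def)
  then have "card M = card (\<Union>i\<in>I. M \<inter> varpair i)" by simp
  also have "\<dots> = (\<Sum>i\<in>I. card (M \<inter> varpair i))"
    using assms(1) by (intro card_UN_disjoint) (auto simp: varpair_def)
  finally show ?thesis .
qed

text \<open>With suitable \<open>g\<close> this yields the degree of the monomials, the number of
  indices used, and the lower bound on the size of a test monomial.\<close>

lemma sum_indices:
  assumes "class_data m rs S T U"
  shows "(\<Sum>i\<in>indices rs S T. g i) = (\<Sum>(r, r')\<in>set rs. g r + g r') + (\<Sum>i\<in>S. g i)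
    + (\<Sum>i\<in>T. (g i :: nat))"
proof -
  note fin = class_dataD[OF assms]
  have d: "distinct (map fst rs)" "distinct (map snd rs)" "fst ` set rs \<inter> snd ` set rs = {}"
    "(fst ` set rs \<union> snd ` set rs) \<inter> S = {}" "(fst ` set rs \<union> snd ` set rs \<union> S) \<inter> T = {}"
    using assms by (auto simp: class_data_def)
  have "(\<Sum>i\<in>indices rs S T. g i) = sum g (fst ` set rs) + sum g (snd ` set rs) + sum g S + sum g T"
    using fin d by (simp add: indices_def sum.union_disjoint)
  also have "sum g (fst ` set rs) + sum g (snd ` set rs) = (\<Sum>(r, r')\<in>set rs. g r + g r')"
    using d by (simp add: sum.reindex distinct_map sum.distrib case_prod_unfold)
  finally show ?thesis .
qed

lemma class_data_card_pairs: "class_data m rs S T U \<Longrightarrow> card (set rs) = length rs"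
  by (auto simp: class_data_def distinct_map distinct_card)

text \<open>Homogeneity: a pair contributes one full and one empty slice, an index in
  \<open>S\<close> a full slice, an index in \<open>T\<close> a slice of size 1.\<close>

lemma fam_member:
  assumes "class_data m rs S T U" "M \<in> fam rs S T z"
  shows "M \<subseteq> vars m" "card M = 2 * length rs + 2 * card S + card T"
proof -
  note fin = class_dataD[OF assms(1)]
  have M: "M \<subseteq> indices rs S T \<times> UNIV" "matches rs S T z M"
    using assms(2) by (auto simp: fam_def)
  show "M \<subseteq> vars m"
    using M(1) assms(1) by (auto simp: vars_def class_data_def)
  have "card M = (\<Sum>i\<in>indices rs S T. card (M \<inter> varpair i))"
    using M(1) fin by (intro card_eq_sum_slices finite_indices) auto
  also have "\<dots> = (\<Sum>(r, r')\<in>set rs. 2) + (\<Sum>i\<in>S. 2) + (\<Sum>i\<in>T. 1)"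
    unfolding sum_indices[OF assms(1)] using M(2)
    by (intro arg_cong2[where f = "(+)"] sum.cong refl) (auto simp: matches_def)
  finally show "card M = 2 * length rs + 2 * card S + card T"
    using class_data_card_pairs[OF assms(1)] by (simp add: case_prod_unfold)
qed

section \<open>Generators and overfull monomials span\<close>

interpretation sf: vector_space "sf_scale :: 'k::field \<Rightarrow> 'k sfpoly \<Rightarrow> 'k sfpoly"
  by unfold_locales (auto simp: sf_scale_def fun_eq_iff algebra_simps)

lemma ind_in_span:
  fixes Q :: "'k::field sfpoly set"
  assumes "finite \<A>" "\<And>M. M \<in> \<A> \<Longrightarrow> sf_mon M \<in> sf.span Q"
  shows "ind \<A> \<in> sf.span Q"
  using assms
proof (induction \<A>)
  case empty
  have "(ind {} :: 'k sfpoly) = 0" by (auto simp: ind_def fun_eq_iff)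
  then show ?case using sf.span_zero by metis
next
  case (insert M \<A>)
  have "(ind ({M} \<union> \<A>) :: 'k sfpoly) = sf_mon M + ind \<A>"
    unfolding sf_mon_eq_ind by (rule ind_Un_disjoint) (use insert.hyps in auto)
  moreover have "sf_mon M + ind \<A> \<in> sf.span Q"
    using insert by (intro sf.span_add) auto
  ultimately show ?case by (simp only: insert_is_Un[of M \<A>])
qed

text \<open>For polynomials free of index \<open>i\<close> and
  \<open>D \<subseteq> varpair i\<close> this is multiplication by the monomial \<open>D\<close>, in
  a form whose linearity is immediate.\<close>

definition lift :: "nat \<Rightarrow> var set \<Rightarrow> 'k::field sfpoly \<Rightarrow> 'k sfpoly" where
  "lift i D f = (\<lambda>M. if M \<inter> varpair i = D then f (M - varpair i) else 0)"

lemma lift_ind: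
  assumes "\<A> \<subseteq> Pow (vars n)" "D \<subseteq> varpair (Suc n)"
  shows "lift (Suc n) D (ind \<A>) = ind ((\<union>) D ` \<A>)"
proof
  fix M
  have "M \<inter> varpair (Suc n) = D \<and> M - varpair (Suc n) \<in> \<A> \<longleftrightarrow> M \<in> (\<union>) D ` \<A>"
  proof
    assume "M \<inter> varpair (Suc n) = D \<and> M - varpair (Suc n) \<in> \<A>"
    then show "M \<in> (\<union>) D ` \<A>" by (intro image_eqI[of _ _ "M - varpair (Suc n)"]) auto
  next
    assume "M \<in> (\<union>) D ` \<A>"
    then obtain N where N: "M = D \<union> N" "N \<in> \<A>" by blast
    then have "N \<subseteq> vars n" using assms by auto
    then have "N \<inter> varpair (Suc n) = {}" using vars_disjoint_varpair[of n] by auto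
    then have "M \<inter> varpair (Suc n) = D" "M - varpair (Suc n) = N"
      using N(1) assms(2) by auto
    then show "M \<inter> varpair (Suc n) = D \<and> M - varpair (Suc n) \<in> \<A>" using N by simp
  qed
  then show "lift (Suc n) D (ind \<A>) M = ind ((\<union>) D ` \<A>) M"
    unfolding lift_def ind_def by auto
qed

text \<open>By linearity it suffices to check generators; this is how the induction hypothesis gets
  multiplied by the slice at a new index.\<close>

lemma lift_in_span:
  fixes f :: "'k::field sfpoly"
  assumes "f \<in> sf.span B" "\<And>g. g \<in> B \<Longrightarrow> lift i D g \<in> sf.span Q"
  shows "lift i D f \<in> sf.span Q"
proof -
  have "sf.subspace {f. lift i D f \<in> sf.span Q}"
  proof (rule sf.subspaceI)
    have "lift i D (0 :: 'k sfpoly) = 0" by (auto simp: lift_def fun_eq_iff)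
    then show "0 \<in> {f. lift i D f \<in> sf.span Q}"
      by (simp only: mem_Collect_eq sf.span_zero)
  next
    fix f g :: "'k sfpoly"
    have "lift i D (f + g) = lift i D f + lift i D g" by (auto simp: lift_def fun_eq_iff)
    then show "f \<in> {f. lift i D f \<in> sf.span Q} \<Longrightarrow> g \<in> {f. lift i D f \<in> sf.span Q} \<Longrightarrow>
        f + g \<in> {f. lift i D f \<in> sf.span Q}"
      by (simp only: mem_Collect_eq sf.span_add)
  next
    fix c and f :: "'k sfpoly"
    have "lift i D (sf_scale c f) = sf_scale c (lift i D f)"
      by (auto simp: lift_def sf_scale_def fun_eq_iff)
    then show "f \<in> {f. lift i D f \<in> sf.span Q} \<Longrightarrow> sf_scale c f \<in> {f. lift i D f \<in> sf.span Q}"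
      by (simp only: mem_Collect_eq sf.span_scale)
  qed
  then have "sf.span B \<subseteq> {f. lift i D f \<in> sf.span Q}"
    using assms(2) by (intro sf.span_minimal) auto
  then show ?thesis using assms(1) by auto
qed

definition overfull_monomials :: "nat \<Rightarrow> nat \<Rightarrow> nat \<Rightarrow> var set set" where
  "overfull_monomials n k l = {M. M \<subseteq> vars n \<and> card M = k \<and> overfull l n M}"

lemma ind_fam_in_P_set:
  "class_data n rs S T U \<Longrightarrow> 2 * length rs + 2 * card S + card T = k \<Longrightarrow> card S \<le> l \<Longrightarrow>
    ind (fam rs S T z) \<in> P_set n k l"
  unfolding mem_P_set_iff by blast

lemma class_data_card:
  assumes "class_data n rs S T U"
  shows "2 * length rs + card S + card T + card U = n"
proof -
  note fin = class_dataD[OF assms]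
  have "card (indices rs S T) = 2 * length rs + card S + card T"
    using sum_indices[OF assms, of "\<lambda>_. 1"] class_data_card_pairs[OF assms]
    by (simp add: case_prod_unfold)
  moreover have "card (indices rs S T \<union> U) = card (indices rs S T) + card U"
    using fin assms by (intro card_Un_disjoint finite_indices) (auto simp: class_data_def)
  moreover have "indices rs S T \<union> U = {1..n}" using assms by (simp add: class_data_def)
  ultimately show ?thesis by simp
qed

lemma class_data_notin: "class_data n rs S T U \<Longrightarrow> i \<in> U \<or> i > n \<Longrightarrow> i \<notin> indices rs S T"
  unfolding class_data_def by (metis IntI Un_iff atLeastAtMost_iff empty_iff not_le)

text \<open>The moves of the spanning induction: leave the new index out, give it a factor W or Z,
  or pair it with a free index \<open>r\<close>. The last one describes the correction term
  \<open>W r\<close> times the old product, which stays within the old indices.\<close>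

lemma class_data_Suc:
  assumes "class_data n rs S T U"
  shows "class_data (Suc n) rs S T (insert (Suc n) U)"
    and "class_data (Suc n) rs (insert (Suc n) S) T U"
    and "class_data (Suc n) rs S (insert (Suc n) T) U"
    and "r \<in> U \<Longrightarrow> class_data (Suc n) ((r, Suc n) # rs) S T (U - {r})"
    and "r \<in> U \<Longrightarrow> class_data n rs (insert r S) T (U - {r})"
proof -
  have n: "Suc n \<notin> indices rs S T" using class_data_notin[OF assms] by simp
  have U: "Suc n \<notin> U" using assms by (auto simp: class_data_def)
  have Suc: "{1..Suc n} = insert (Suc n) (indices rs S T \<union> U)" "{1..n} = indices rs S T \<union> U"
    using assms by (simp_all add: class_data_def atLeastAtMostSuc_conv)
  have d: "distinct (map fst rs @ map snd rs)" "indices rs S T \<inter> U = {}"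
    "(fst ` set rs \<union> snd ` set rs) \<inter> (S \<union> T) = {}" "S \<inter> T = {}"
    using assms unfolding class_data_def by blast+
  show "class_data (Suc n) rs S T (insert (Suc n) U)"
    unfolding class_data_def Suc using d n by auto
  have nST: "Suc n \<notin> fst ` set rs \<union> snd ` set rs" "Suc n \<notin> S" "Suc n \<notin> T"
    using n by (auto simp: indices_def)
  show "class_data (Suc n) rs (insert (Suc n) S) T U" "class_data (Suc n) rs S (insert (Suc n) T) U"
    unfolding class_data_def Suc indices_simps using d U nST by auto
  assume r: "r \<in> U"
  then have "r \<notin> indices rs S T" "r \<noteq> Suc n" using class_data_notin[OF assms] U by auto
  moreover from this have "r \<notin> fst ` set rs \<union> snd ` set rs" "r \<notin> S" "r \<notin> T"
    by (auto simp: indices_def)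
  ultimately show "class_data (Suc n) ((r, Suc n) # rs) S T (U - {r})"
    "class_data n rs (insert r S) T (U - {r})"
    unfolding class_data_def Suc indices_simps using d U nST n r by auto
qed

lemma fam_subset_vars: "class_data n rs S T U \<Longrightarrow> fam rs S T z \<subseteq> Pow (vars n)"
  using fam_member(1) by blast

lemma P_set_Suc: "P_set n k l \<subseteq> P_set (Suc n) k l"
proof
  fix F :: "'a sfpoly"
  assume "F \<in> P_set n k l"
  then obtain rs S T U z where "class_data n rs S T U" "2 * length rs + 2 * card S + card T = k"
    "card S \<le> l" "F = ind (fam rs S T z)"
    unfolding mem_P_set_iff by blast
  then show "F \<in> P_set (Suc n) k l"
    using ind_fam_in_P_set[OF class_data_Suc(1)] by simp
qed

lemma overfull_monomials_Suc:
  assumes "M \<in> overfull_monomials n k l" "D \<subseteq> varpair (Suc n)" "k + card D \<le> Suc n + l"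
  shows "M \<union> D \<in> overfull_monomials (Suc n) (k + card D) l"
proof -
  have M: "M \<subseteq> vars n" "card M = k" "overfull l n M"
    using assms(1) by (auto simp: overfull_monomials_def)
  then have "overfull l (Suc n) (M \<union> D)" "card (M \<union> D) = k + card D"
    using assms(2,3) overfull_Suc[of M n D l] card_union_parts[of M n D] by simp_all
  then show ?thesis
    using M(1) assms(2) by (auto simp: overfull_monomials_def vars_Suc)
qed

lemma fam_upd:
  assumes "i \<notin> T"
  shows "fam rs S T (z(i := b)) = fam rs S T z"
proof -
  have "(\<forall>j\<in>T. M \<inter> varpair j = {(j, (z(i := b)) j)}) \<longleftrightarrow> (\<forall>j\<in>T. M \<inter> varpair j = {(j, z j)})" for M
    using assms by (intro ball_cong refl) (metis fun_upd_apply)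
  then show ?thesis unfolding fam_def matches_def by (simp only:)
qed

text \<open>The induction hypothesis is used twice: on the part \<open>N\<close> of \<open>M\<close>
  below the last index, and, in the full degree of \<open>M\<close>, on the monomials of the
  correction term.\<close>

lemma sf_mon_in_span_P_set_overfull:
  assumes "M \<subseteq> vars n" "card M \<le> n + l + 1"
  shows "(sf_mon M :: 'k::field sfpoly)
    \<in> sf.span (P_set n (card M) l \<union> sf_mon ` overfull_monomials n (card M) l)"
  using assms
proof (induction n arbitrary: M)
  case 0
  have "class_data 0 [] {} {} {}" by (auto simp: class_data_def indices_def)
  then have "(ind (fam [] {} {} (\<lambda>_. False)) :: 'k sfpoly) \<in> P_set 0 0 l"
    by (rule ind_fam_in_P_set) auto
  then show ?case using 0 by (auto simp: sf_mon_eq_ind intro: sf.span_base)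
next
  case (Suc n)
  let ?G = "\<lambda>n k. P_set n k l \<union> sf_mon ` overfull_monomials n k l :: 'k sfpoly set"
  show ?case
  \<comment> \<open>In the top degree \<open>M\<close> is itself overfull; otherwise the degree is
    at most \<open>n + l + 1\<close>, as both uses of the induction hypothesis require.\<close>
  proof (cases "card M = Suc n + l + 1")
    case True
    then have "M \<in> overfull_monomials (Suc n) (card M) l"
      using Suc.prems by (auto simp: overfull_monomials_def intro: overfull_if_card)
    then show ?thesis by (auto intro: sf.span_base)
  next
    case False
    obtain N D where ND: "M = N \<union> D" "N \<subseteq> vars n" "D \<subseteq> varpair (Suc n)"
      by (rule subset_vars_Suc_E[OF Suc.prems(1)])
    have card: "card M = card N + card D" using ND card_union_parts by simp
    have le: "card N + card D \<le> Suc n + l" using False Suc.prems card by simp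
    have G_Suc: "?G n k \<subseteq> ?G (Suc n) k" if "k \<le> Suc n + l" for k
    proof -
      have "overfull_monomials n k l \<subseteq> overfull_monomials (Suc n) k l"
        using overfull_monomials_Suc[of _ n k l "{}"] that by auto
      then show ?thesis using P_set_Suc by blast
    qed
    have lift: "lift (Suc n) D g \<in> sf.span (?G (Suc n) (card M))" if "g \<in> ?G n (card N)" for g
      using that
    proof
      assume "g \<in> sf_mon ` overfull_monomials n (card N) l"
      then obtain M' where M': "g = sf_mon M'" "M' \<in> overfull_monomials n (card N) l" by blast
      have "lift (Suc n) D g = sf_mon (M' \<union> D)"
        using M' ND(3) lift_ind[of "{M'}" n D]
        by (simp add: sf_mon_eq_ind overfull_monomials_def Un_commute)
      then show ?thesis
        using overfull_monomials_Suc[OF M'(2) ND(3) le] card by (auto intro: sf.span_base)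
    next
      assume "g \<in> P_set n (card N) l"
      then obtain rs S T U z where cd: "class_data n rs S T U"
        "2 * length rs + 2 * card S + card T = card N" "card S \<le> l" and g: "g = ind (fam rs S T z)"
        unfolding mem_P_set_iff by blast
      note fin = class_dataD[OF cd(1)] and cd_Suc = class_data_Suc[OF cd(1)]
      have n: "Suc n \<notin> indices rs S T" using class_data_notin[OF cd(1)] by simp
      then have nST: "Suc n \<notin> S" "Suc n \<notin> T" by (auto simp: indices_def)
      have lg: "lift (Suc n) D g = ind ((\<union>) D ` fam rs S T z)"
        unfolding g by (rule lift_ind[OF fam_subset_vars[OF cd(1)] ND(3)])
      have "D \<in> Pow (varpair (Suc n))" using ND by simp
      then consider "D = {}" | b where "D = {(Suc n, b)}" | "D = varpair (Suc n)"
        unfolding Pow_varpair by auto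
      then show ?thesis
      proof cases
        case 1
        then have "lift (Suc n) D g \<in> P_set (Suc n) (card M) l"
          using lg cd card by (auto intro!: ind_fam_in_P_set[OF cd_Suc(1)])
        then show ?thesis by (auto intro: sf.span_base)
      next
        case 2
        then have "lift (Suc n) D g = ind (fam rs S (insert (Suc n) T) (z(Suc n := b)))"
          using lg n nST by (simp add: fam_insert_T fam_upd)
        also have "\<dots> \<in> P_set (Suc n) (card M) l"
          using cd card 2 fin nST by (intro ind_fam_in_P_set[OF cd_Suc(3)]) auto
        finally show ?thesis by (auto intro: sf.span_base)
      next
        case 3
        show ?thesis
        proof (cases "card S < l")
          case True
          have "lift (Suc n) D g = ind (fam rs (insert (Suc n) S) T z)"
            using lg n 3 by (simp add: fam_insert_S)
          also have "\<dots> \<in> P_set (Suc n) (card M) l"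
            using True cd card 3 fin nST by (intro ind_fam_in_P_set[OF cd_Suc(2)]) auto
          finally show ?thesis by (auto intro: sf.span_base)
        next
          case False
          \<comment> \<open>Here \<open>card S = l\<close>. Without a free index the index count
            would give \<open>card N = n + l\<close>, but \<open>le\<close> with
            \<open>card D = 2\<close> allows at most \<open>n + l - 1\<close>.\<close>
          have "card U > 0"
            using class_data_card[OF cd(1)] cd le False 3 by simp
          then obtain r where r: "r \<in> U" by (metis card_gt_0_iff ex_in_conv)
          then have rn: "r \<notin> indices rs S T" "r \<noteq> Suc n"
            using class_data_notin[OF cd(1)] cd(1) by (auto simp: class_data_def)
          have eq: "fam ((r, Suc n) # rs) S T z = (\<union>) (varpair r) ` fam rs S T z \<union> (\<union>) D ` fam rs S T z"
            unfolding 3 using rn n by (intro fam_Cons)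
          have "(ind (fam ((r, Suc n) # rs) S T z) :: 'k sfpoly)
              = ind ((\<union>) (varpair r) ` fam rs S T z) + ind ((\<union>) D ` fam rs S T z)"
            unfolding eq
            by (rule ind_Un_disjoint) (use rn n 3 in \<open>auto simp: fam_def varpair_def\<close>)
          then have lift_eq: "lift (Suc n) D g
              = ind (fam ((r, Suc n) # rs) S T z) - ind (fam rs (insert r S) T z)"
            unfolding lg fam_insert_S[OF rn(1)] by (simp only: add_diff_cancel_left')
          have "(ind (fam ((r, Suc n) # rs) S T z) :: 'k sfpoly) \<in> P_set (Suc n) (card M) l"
            using cd card 3 by (intro ind_fam_in_P_set[OF cd_Suc(4)[OF r]]) auto
          \<comment> \<open>\<open>insert r S\<close> exceeds the bound \<open>l\<close>, so this
            product is expanded into monomials; they live on the first \<open>n\<close> indices and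
            have degree \<open>card M \<le> n + l + 1\<close>.\<close>
          moreover have "ind (fam rs (insert r S) T z) \<in> sf.span (?G n (card M))"
          proof (rule ind_in_span)
            have "fam rs (insert r S) T z \<subseteq> Pow (vars n)"
              using fam_subset_vars[OF cd_Suc(5)[OF r]] .
            then show "finite (fam rs (insert r S) T z)" by (rule finite_subset) simp
            fix M' assume "M' \<in> fam rs (insert r S) T z"
            note M' = fam_member[OF cd_Suc(5)[OF r] this]
            have "r \<notin> S" using rn(1) by (auto simp: indices_def)
            then have "card M' = card M"
              using M'(2) fin cd(2) card 3 by simp
            then show "sf_mon M' \<in> sf.span (?G n (card M))"
              using Suc.IH[OF M'(1)] card le by simp
          qed
          then have "ind (fam rs (insert r S) T z) \<in> sf.span (?G (Suc n) (card M))"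
            using sf.span_mono[OF G_Suc[of "card M"]] card le by auto
          ultimately show ?thesis
            unfolding lift_eq by (intro sf.span_diff) (auto intro: sf.span_base)
        qed
      qed
    qed
    have "card N \<le> n + l + 1" using le by simp
    then have "lift (Suc n) D (sf_mon N) \<in> sf.span (?G (Suc n) (card M))"
      by (rule lift_in_span[OF Suc.IH[OF ND(2)] lift])
    moreover have "lift (Suc n) D (sf_mon N) = (sf_mon M :: 'k sfpoly)"
      using ND lift_ind[of "{N}" n D] by (simp add: sf_mon_eq_ind Un_commute)
    ultimately show ?thesis by simp
  qed
qed

section \<open>Functionals vanishing on the generators\<close>

text \<open>The functionals that cut out the span of \<open>P_set\<close>: tensor products, over the indices \<open>i\<close>, of
  the coefficient functionals of \<open>X_i\<close>, \<open>Y_i\<close>, \<open>W_i\<close> and of the sum of the coefficients of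
  1 and \<open>W_i\<close>.\<close>

definition compatible :: "var set \<Rightarrow> var set \<Rightarrow> bool" where
  "compatible N M \<longleftrightarrow> (\<forall>i. M \<inter> varpair i = N \<inter> varpair i \<or>
     N \<inter> varpair i = {} \<and> M \<inter> varpair i = varpair i)"

definition pairing :: "nat \<Rightarrow> var set \<Rightarrow> 'k::field sfpoly \<Rightarrow> 'k" where
  "pairing n N f = (\<Sum>M\<in>Pow (vars n). if compatible N M then f M else 0)"

lemma pairing_add: "pairing n N (f + g) = pairing n N f + pairing n N g"
  unfolding pairing_def sum.distrib[symmetric] by (intro sum.cong) auto

lemma pairing_scale: "pairing n N (sf_scale c f) = c * pairing n N f"
  unfolding pairing_def sf_scale_def sum_distrib_left by (intro sum.cong) auto

lemma compatible_Un_iff: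
  assumes "N \<subseteq> vars n" "N' \<subseteq> vars n" "D \<subseteq> varpair (Suc n)" "D' \<subseteq> varpair (Suc n)"
  shows "compatible (N \<union> D) (N' \<union> D')
    \<longleftrightarrow> compatible N N' \<and> (D' = D \<or> D = {} \<and> D' = varpair (Suc n))"
proof -
  have n: "A \<inter> varpair (Suc n) = {}" if "A \<subseteq> vars n" for A
    using that vars_disjoint_varpair[of n] by blast
  have i: "E \<inter> varpair i = {}" if "i \<noteq> Suc n" "E \<subseteq> varpair (Suc n)" for E i
    using that varpair_disjoint[of i "Suc n"] by blast
  have "compatible (N \<union> D) (N' \<union> D') \<longleftrightarrow>
      (\<forall>i. i \<noteq> Suc n \<longrightarrow> N' \<inter> varpair i = N \<inter> varpair i \<or>
         N \<inter> varpair i = {} \<and> N' \<inter> varpair i = varpair i) \<and>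
      (D' = D \<or> D = {} \<and> D' = varpair (Suc n))"
    unfolding compatible_def Int_Un_distrib2
    using n[OF assms(1)] n[OF assms(2)] i[OF _ assms(3)] i[OF _ assms(4)]
      Int_absorb2[OF assms(3)] Int_absorb2[OF assms(4)]
    by (metis Un_empty_left Un_empty_right)
  also have "\<dots> \<longleftrightarrow> compatible N N' \<and> (D' = D \<or> D = {} \<and> D' = varpair (Suc n))"
    unfolding compatible_def using n[OF assms(1)] n[OF assms(2)] by metis
  finally show ?thesis .
qed

text \<open>The functional is a tensor product, so its factor at the last index only selects the
  slices \<open>D'\<close> that survive.\<close>

lemma pairing_Suc:
  assumes "N \<subseteq> vars n" "D \<subseteq> varpair (Suc n)"
  shows "pairing (Suc n) (N \<union> D) f = (\<Sum>D'\<in>Pow (varpair (Suc n)).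
    if D' = D \<or> D = {} \<and> D' = varpair (Suc n) then pairing n N (\<lambda>M. f (M \<union> D')) else 0)"
  unfolding pairing_def sum_Pow_vars_Suc
proof (rule sum.cong[OF refl])
  fix D' assume "D' \<in> Pow (varpair (Suc n))"
  then have iff: "compatible (N \<union> D) (M \<union> D')
      \<longleftrightarrow> compatible N M \<and> (D' = D \<or> D = {} \<and> D' = varpair (Suc n))" if "M \<in> Pow (vars n)" for M
    using that assms by (intro compatible_Un_iff) auto
  show "(\<Sum>M\<in>Pow (vars n). if compatible (N \<union> D) (M \<union> D') then f (M \<union> D') else 0)
      = (if D' = D \<or> D = {} \<and> D' = varpair (Suc n)
         then \<Sum>M\<in>Pow (vars n). if compatible N M then f (M \<union> D') else 0 else 0)"
    by (cases "D' = D \<or> D = {} \<and> D' = varpair (Suc n)")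
      (simp_all only: iff if_True if_False simp_thms sum.neutral_const cong: sum.cong)
qed

lemma pairing_Suc_nonempty:
  assumes "N \<subseteq> vars n" "D \<subseteq> varpair (Suc n)" "D \<noteq> {}"
  shows "pairing (Suc n) (N \<union> D) f = pairing n N (\<lambda>M. f (M \<union> D))"
  using assms(2,3) unfolding pairing_Suc[OF assms(1,2)] by simp

text \<open>This is the only case in which two parts of \<open>f\<close> are coupled: the part free
  of the last index and the part divisible by W at that index.\<close>

lemma pairing_Suc_empty:
  assumes "N \<subseteq> vars n"
  shows "pairing (Suc n) N f = pairing n N f + pairing n N (\<lambda>M. f (M \<union> varpair (Suc n)))"
  using pairing_Suc[OF assms, of "{}" f] unfolding sum_Pow_varpair
  by (simp add: varpair_neq_singleton)

lemma pairing_cong: "(\<And>M. M \<subseteq> vars n \<Longrightarrow> f M = g M) \<Longrightarrow> pairing n N f = pairing n N g"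
  unfolding pairing_def by (intro sum.cong) auto

lemma pairing_zero [simp]: "pairing n N (\<lambda>M. 0) = 0"
  by (simp add: pairing_def)

text \<open>Needed in the extreme degree \<open>n + l + 1\<close>, where every monomial is overfull. Letting \<open>k\<close> and \<open>j\<close> vary
  independently allows first to kill the part of \<open>f\<close> free of the last index, at the price of \<open>j - 2\<close>;
  after that the part divisible by \<open>W\<^sub>n\<close> is annihilated by functionals up to the full degree \<open>j\<close>.\<close>

lemma eq_zero_if_pairing_zero_high_degree:
  assumes "\<And>M. M \<subseteq> vars n \<Longrightarrow> f M \<noteq> 0 \<Longrightarrow> int (card M) = k"
    and "\<And>N. N \<subseteq> vars n \<Longrightarrow> int (card N) \<le> j \<Longrightarrow> pairing n N f = 0"
    and "2 * int n \<le> k + j" "M \<subseteq> vars n"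
  shows "f M = 0"
  using assms
proof (induction n arbitrary: f k j M)
  case 0
  show ?case
  proof (rule ccontr)
    assume f: "f M \<noteq> 0"
    \<comment> \<open>A nonzero constant forces degree 0, and then \<open>0 \<le> j\<close> admits
      the empty \<open>N\<close>.\<close>
    then have "k = 0" using 0 by fastforce
    then have "pairing 0 {} f = 0" using 0 by simp
    then show False using f 0 by (simp add: pairing_def compatible_def)
  qed
next
  case (Suc n)
  let ?V = "varpair (Suc n)"
  have deg: "int (card M) = k - int (card D)" if "M \<subseteq> vars n" "D \<subseteq> ?V" "f (M \<union> D) \<noteq> 0" for M D
  proof -
    have "M \<union> D \<subseteq> vars (Suc n)" using that by (auto simp: vars_Suc)
    then show ?thesis using that Suc.prems(1)[of "M \<union> D"] card_union_parts[of M n D] by simp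
  qed
  have pair: "pairing n N (\<lambda>M. f (M \<union> D)) = 0"
    if "N \<subseteq> vars n" "D \<subseteq> ?V" "D \<noteq> {}" "int (card N) \<le> j - int (card D)" for N D
  proof -
    have "N \<union> D \<subseteq> vars (Suc n)" using that by (auto simp: vars_Suc)
    then show ?thesis
      using that Suc.prems(2)[of "N \<union> D"] card_union_parts[of N n D] pairing_Suc_nonempty[of N n D f]
      by simp
  qed
  have pair_empty: "pairing n N f + pairing n N (\<lambda>M. f (M \<union> ?V)) = 0"
    if "N \<subseteq> vars n" "int (card N) \<le> j" for N
    using that Suc.prems(2)[of N] pairing_Suc_empty[of N n f] by (auto simp: vars_Suc)
  have single: "f (M \<union> {(Suc n, b)}) = 0" if "M \<subseteq> vars n" for M b
  proof (rule Suc.IH[where k = "k - 1" and j = "j - 1" and f = "\<lambda>M. f (M \<union> {(Suc n, b)})"])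
    fix N assume "N \<subseteq> vars n" "int (card N) \<le> j - 1"
    then show "pairing n N (\<lambda>M. f (M \<union> {(Suc n, b)})) = 0"
      by (intro pair) (auto simp: varpair_def)
  next
    fix M assume "M \<subseteq> vars n" "f (M \<union> {(Suc n, b)}) \<noteq> 0"
    then show "int (card M) = k - 1"
      using deg[of M "{(Suc n, b)}"] by (auto simp: varpair_def)
  qed (use Suc.prems that in auto)
  \<comment> \<open>Subtracting the functional with full last slice isolates the free part. This
    needs \<open>card N + 2 \<le> j\<close>, and \<open>2 * n \<le> k + (j - 2)\<close> still
    holds.\<close>
  have zero: "f M = 0" if "M \<subseteq> vars n" for M
  proof (rule Suc.IH[where k = k and j = "j - 2"])
    fix N assume N: "N \<subseteq> vars n" "int (card N) \<le> j - 2"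
    then show "pairing n N f = 0"
      using pair_empty[of N] pair[of N ?V] by simp
  next
    fix M assume "M \<subseteq> vars n" "f M \<noteq> 0"
    then show "int (card M) = k" using deg[of M "{}"] by simp
  qed (use Suc.prems that in auto)
  \<comment> \<open>With the free part gone, \<open>j\<close> can be kept; only the degree drops by
    2, so the sum of the two bounds is again large enough.\<close>
  have full: "f (M \<union> ?V) = 0" if "M \<subseteq> vars n" for M
  proof (rule Suc.IH[where k = "k - 2" and j = j and f = "\<lambda>M. f (M \<union> ?V)"])
    fix N assume N: "N \<subseteq> vars n" "int (card N) \<le> j"
    have "pairing n N f = 0"
      using pairing_cong[of n f "\<lambda>_. 0" N] zero by simp
    then show "pairing n N (\<lambda>M. f (M \<union> ?V)) = 0"
      using pair_empty[OF N] by simp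
  next
    fix M assume "M \<subseteq> vars n" "f (M \<union> ?V) \<noteq> 0"
    then show "int (card M) = k - 2" using deg[of M ?V] by simp
  qed (use Suc.prems that in auto)
  obtain N D where ND: "M = N \<union> D" "N \<subseteq> vars n" "D \<subseteq> ?V"
    by (rule subset_vars_Suc_E[OF Suc.prems(4)])
  have "D \<in> Pow ?V" using ND(3) by simp
  then consider "D = {}" | b where "D = {(Suc n, b)}" | "D = ?V"
    unfolding Pow_varpair by auto
  then show ?case
    using ND single zero full by cases auto
qed

text \<open>Below the top degree overfullness passes to the first \<open>n\<close> indices. The
  parts with nonempty last slice are killed first, since for them the degree and the bound on
  \<open>N\<close> drop together; then the free part follows. In the base case no monomial is
  overfull.\<close>

lemma eq_zero_if_pairing_zero_overfull:
  assumes "\<And>M. M \<subseteq> vars n \<Longrightarrow> f M \<noteq> 0 \<Longrightarrow> int (card M) = k \<and> overfull l n M"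
    and "\<And>N. N \<subseteq> vars n \<Longrightarrow> int (card N) \<le> k - 2 * int l - 2 \<Longrightarrow> pairing n N f = 0"
    and "k \<le> int n + int l + 1" "M \<subseteq> vars n"
  shows "f M = 0"
  using assms
proof (induction n arbitrary: f k M)
  case 0
  then show ?case by (auto simp: overfull_def)
next
  case (Suc n)
  let ?V = "varpair (Suc n)"
  show ?case
  proof (cases "k = int (Suc n) + int l + 1")
    case True
    \<comment> \<open>In the top degree \<open>k + j\<close> with \<open>j = k - 2 * l - 2\<close>
      equals exactly \<open>2 * Suc n\<close>.\<close>
    show ?thesis
      by (rule eq_zero_if_pairing_zero_high_degree[where n = "Suc n" and k = k and j = "k - 2 * int l - 2"])
        (use Suc.prems True in auto)
  next
    case False
    have supp: "int (card M) = k - int (card D) \<and> overfull l n M"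
      if "M \<subseteq> vars n" "D \<subseteq> ?V" "f (M \<union> D) \<noteq> 0" for M D
    proof -
      have "int (card (M \<union> D)) = k" "overfull l (Suc n) (M \<union> D)"
        using that Suc.prems(1)[of "M \<union> D"] by (auto simp: vars_Suc)
      then show ?thesis
        using False Suc.prems(3) card_union_parts[OF that(1,2)] overfull_Suc[OF that(1,2), of l] by auto
    qed
    have nonempty: "f (M \<union> D) = 0" if M: "M \<subseteq> vars n" and D: "D \<subseteq> ?V" "D \<noteq> {}" for M D
    proof (rule Suc.IH[where k = "k - int (card D)" and f = "\<lambda>M. f (M \<union> D)"])
      fix N assume N: "N \<subseteq> vars n" "int (card N) \<le> k - int (card D) - 2 * int l - 2"
      have "pairing (Suc n) (N \<union> D) f = 0"
        using N D card_union_parts[OF N(1) D(1)] by (intro Suc.prems(2)) (auto simp: vars_Suc)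
      then show "pairing n N (\<lambda>M. f (M \<union> D)) = 0"
        using pairing_Suc_nonempty[OF N(1) D, of f] by simp
    next
      have "card D > 0" using D finite_subset[OF D(1)] by (simp add: card_gt_0_iff)
      then show "k - int (card D) \<le> int n + int l + 1" using Suc.prems(3) by simp
    qed (use supp D M in auto)
    have zero: "f M = 0" if M: "M \<subseteq> vars n" for M
    proof (rule Suc.IH[where k = k])
      fix N assume N: "N \<subseteq> vars n" "int (card N) \<le> k - 2 * int l - 2"
      have "pairing n N (\<lambda>M. f (M \<union> ?V)) = 0"
        using pairing_cong[of n "\<lambda>M. f (M \<union> ?V)" "\<lambda>_. 0" N] nonempty[of _ ?V] by simp
      moreover have "pairing (Suc n) N f = 0"
        using N by (intro Suc.prems(2)) (auto simp: vars_Suc)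
      ultimately show "pairing n N f = 0"
        using pairing_Suc_empty[OF N(1), of f] by simp
    next
      fix M assume "M \<subseteq> vars n" "f M \<noteq> 0"
      then show "int (card M) = k \<and> overfull l n M" using supp[of M "{}"] by simp
    qed (use False Suc.prems(3) M in auto)
    obtain N D where ND: "M = N \<union> D" "N \<subseteq> vars n" "D \<subseteq> ?V"
      by (rule subset_vars_Suc_E[OF Suc.prems(4)])
    show ?thesis using ND nonempty zero by (cases "D = {}") auto
  qed
qed

section \<open>Pairings with the generators in characteristic 2\<close>

lemma pairing_ind:
  assumes "\<A> \<subseteq> Pow (vars n)"
  shows "pairing n N (ind \<A> :: 'k::field sfpoly) = of_nat (card {M \<in> \<A>. compatible N M})"
proof -
  have "pairing n N (ind \<A> :: 'k sfpoly)
      = (\<Sum>M\<in>Pow (vars n). if M \<in> {M \<in> \<A>. compatible N M} then 1 else 0)"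
    unfolding pairing_def ind_def by (intro sum.cong) auto
  also have "\<dots> = of_nat (card (Pow (vars n) \<inter> {M \<in> \<A>. compatible N M}))"
    by (simp add: sum.If_cases)
  also have "Pow (vars n) \<inter> {M \<in> \<A>. compatible N M} = {M \<in> \<A>. compatible N M}"
    using assms by blast
  finally show ?thesis .
qed

text \<open>Where the slice of \<open>N\<close> is empty, the slices 1 and \<open>W r\<close> of the
  other monomial count alike.\<close>

lemma compatible_varpair_Un:
  assumes "N \<inter> varpair r = {}" "M \<inter> varpair r = {}"
  shows "compatible N (varpair r \<union> M) \<longleftrightarrow> compatible N M"
proof -
  have "compatible N (varpair r \<union> M) \<longleftrightarrow> (\<forall>i. i \<noteq> r \<longrightarrow> M \<inter> varpair i = N \<inter> varpair i \<or>
     N \<inter> varpair i = {} \<and> M \<inter> varpair i = varpair i)"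
    unfolding compatible_def Int_Un_distrib2 using assms varpair_disjoint
    by (metis Int_absorb Un_empty_left Un_empty_right)
  also have "\<dots> \<longleftrightarrow> compatible N M"
    unfolding compatible_def using assms by metis
  finally show ?thesis .
qed

lemma card_compatible_varpair_Un:
  assumes "N \<inter> varpair r = {}" "\<And>M. M \<in> \<A> \<Longrightarrow> M \<inter> varpair r = {}"
  shows "card {M \<in> (\<union>) (varpair r) ` \<A>. compatible N M} = card {M \<in> \<A>. compatible N M}"
proof -
  have "{M \<in> (\<union>) (varpair r) ` \<A>. compatible N M} = (\<union>) (varpair r) ` {M \<in> \<A>. compatible N M}"
    using compatible_varpair_Un[OF assms] by blast
  moreover have "inj_on ((\<union>) (varpair r)) {M \<in> \<A>. compatible N M}"
    using assms(2) by (intro inj_onI) blast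
  ultimately show ?thesis by (simp add: card_image)
qed

lemma fam_set_cong: "set rs = set rs' \<Longrightarrow> fam rs S T z = fam rs' S T z"
  by (simp add: fam_def matches_def indices_def)

text \<open>If \<open>N\<close> misses both indices of some pair, the two summands have equally many
  compatible monomials, so the total is even. Otherwise a compatible monomial forces
  \<open>N\<close> to fill a slice of each pair and to meet each slice of \<open>T\<close>, which
  takes at least \<open>2 * length rs + card T\<close> variables.\<close>

lemma pairing_fam_eq_zero:
  assumes char: "CHAR('k::field) = 2"
    and cd: "class_data n rs S T U" and N: "N \<subseteq> vars n" "card N < 2 * length rs + card T"
  shows "pairing n N (ind (fam rs S T z) :: 'k sfpoly) = 0"
proof (cases "\<exists>(r, r')\<in>set rs. N \<inter> varpair r = {} \<and> N \<inter> varpair r' = {}")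
  case True
  then obtain r r' where r: "(r, r') \<in> set rs" "N \<inter> varpair r = {}" "N \<inter> varpair r' = {}" by blast
  \<comment> \<open>The chosen pair may be moved to the front because \<open>fam\<close> depends
    only on the set of pairs.\<close>
  then obtain xs ys where rs: "rs = xs @ (r, r') # ys" by (metis split_list)
  define \<A> where "\<A> = fam (xs @ ys) S T z"
  have r_notin: "r \<noteq> r'" "r \<notin> indices (xs @ ys) S T" "r' \<notin> indices (xs @ ys) S T"
    using cd unfolding class_data_def rs by (auto simp: indices_def)
  have split: "fam rs S T z = (\<union>) (varpair r) ` \<A> \<union> (\<union>) (varpair r') ` \<A>"
    using fam_Cons[OF r_notin, of z] fam_set_cong[of rs "(r, r') # xs @ ys"] unfolding \<A>_def rs by simp
  have sub: "fam rs S T z \<subseteq> Pow (vars n)" using fam_subset_vars[OF cd] .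
  have disj: "(\<union>) (varpair r) ` \<A> \<inter> (\<union>) (varpair r') ` \<A> = {}"
    using r_notin by (auto simp: \<A>_def fam_def varpair_def)
  have "pairing n N (ind (fam rs S T z) :: 'k sfpoly)
      = pairing n N (ind ((\<union>) (varpair r) ` \<A>)) + pairing n N (ind ((\<union>) (varpair r') ` \<A>))"
    unfolding split ind_Un_disjoint[OF disj] by (rule pairing_add)
  also have "\<dots> = of_nat (2 * card {M \<in> \<A>. compatible N M})"
    using sub r r_notin fam_Int_varpair unfolding split
    by (simp add: pairing_ind card_compatible_varpair_Un \<A>_def)
  also have "\<dots> = 0"
    using char of_nat_CHAR[where 'a = 'k] by simp
  finally show ?thesis .
next
  case False
  note fin = class_dataD[OF cd]
  have "\<not> compatible N M" if M: "M \<in> fam rs S T z" for M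
  proof
    assume comp: "compatible N M"
    have m: "matches rs S T z M" using M by (simp add: fam_def)
    have full: "N \<inter> varpair i = M \<inter> varpair i" if "N \<inter> varpair i \<noteq> {}" for i
      using comp that unfolding compatible_def by metis
    have pair: "2 \<le> card (N \<inter> varpair r) + card (N \<inter> varpair r')" if r: "(r, r') \<in> set rs" for r r'
    proof -
      have "N \<inter> varpair r \<noteq> {} \<or> N \<inter> varpair r' \<noteq> {}" using False r by blast
      moreover have "M \<inter> varpair r \<in> {{}, varpair r}" "M \<inter> varpair r' \<in> {{}, varpair r'}"
        using m r by (auto simp: matches_def)
      ultimately have "N \<inter> varpair r = varpair r \<or> N \<inter> varpair r' = varpair r'"
        using full[of r] full[of r'] by auto
      then show ?thesis by auto
    qed
    have single: "1 \<le> card (N \<inter> varpair i)" if "i \<in> T" for i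
    proof -
      have "M \<inter> varpair i = {(i, z i)}" using m that by (simp add: matches_def)
      \<comment> \<open>A slice of size 1 differs from \<open>varpair i\<close>, which excludes the
        second alternative in \<open>compatible\<close>.\<close>
      then have "N \<inter> varpair i = {(i, z i)}"
        using comp varpair_neq_singleton unfolding compatible_def by metis
      then show ?thesis by simp
    qed
    have "2 * length rs + card T = (\<Sum>(r, r')\<in>set rs. 2) + (\<Sum>i\<in>T. 1)"
      using class_data_card_pairs[OF cd] by (simp add: case_prod_unfold)
    also have "\<dots> \<le> (\<Sum>(r, r')\<in>set rs. card (N \<inter> varpair r) + card (N \<inter> varpair r'))
        + (\<Sum>i\<in>T. card (N \<inter> varpair i))"
      using pair single by (intro add_mono sum_mono) auto
    also have "\<dots> \<le> (\<Sum>i\<in>indices rs S T. card (N \<inter> varpair i))"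
      unfolding sum_indices[OF cd] by simp
    also have "\<dots> \<le> (\<Sum>i\<in>{1..n}. card (N \<inter> varpair i))"
      using cd by (intro sum_mono2) (auto simp: class_data_def)
    also have "\<dots> = card N"
      using N(1) by (intro card_eq_sum_slices[symmetric]) (auto simp: vars_def)
    finally show False using N(2) by simp
  qed
  then have none: "{M \<in> fam rs S T z. compatible N M} = {}" by blast
  show ?thesis
    unfolding pairing_ind[OF fam_subset_vars[OF cd]] none by simp
qed

lemma pairing_span_P_set_eq_zero:
  assumes char: "CHAR('k::field) = 2" and f: "(f :: 'k sfpoly) \<in> sf.span (P_set n k l)"
    and N: "N \<subseteq> vars n" "int (card N) \<le> int k - 2 * int l - 2"
  shows "pairing n N f = 0"
proof -
  have "sf.subspace {f :: 'k sfpoly. pairing n N f = 0}"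
    by (rule sf.subspaceI) (simp_all add: pairing_add pairing_scale zero_fun_def)
  moreover have "P_set n k l \<subseteq> {f :: 'k sfpoly. pairing n N f = 0}"
  proof
    fix g :: "'k sfpoly"
    assume "g \<in> P_set n k l"
    then obtain rs S T U z where cd: "class_data n rs S T U"
      "2 * length rs + 2 * card S + card T = k" "card S \<le> l" and g: "g = ind (fam rs S T z)"
      unfolding mem_P_set_iff by blast
    \<comment> \<open>From \<open>card S \<le> l\<close> the right-hand side is at least
      \<open>k - 2 * l\<close>, and \<open>card N\<close> is at most
      \<open>k - 2 * l - 2\<close>.\<close>
    have "card N < 2 * length rs + card T" using N cd by simp
    then show "g \<in> {f. pairing n N f = 0}"
      using pairing_fam_eq_zero[OF char cd(1) N(1)] g by simp
  qed
  ultimately have "sf.span (P_set n k l) \<subseteq> {f :: 'k sfpoly. pairing n N f = 0}"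
    by (rule sf.span_minimal[rotated])
  then show ?thesis using f by blast
qed

section \<open>Independence of monomials and the dimension formula\<close>

lemma span_sf_mon_support:
  assumes "f \<in> sf.span (sf_mon ` \<A>)" "f M \<noteq> 0"
  shows "M \<in> \<A>"
proof (rule ccontr)
  assume M: "M \<notin> \<A>"
  have "sf.subspace {f. f M = 0}"
    by (rule sf.subspaceI) (simp_all add: sf_scale_def)
  then have "sf.span (sf_mon ` \<A>) \<subseteq> {f. f M = 0}"
    using M by (intro sf.span_minimal) (auto simp: sf_mon_def)
  then show False using assms by blast
qed

lemma inj_sf_mon: "inj (sf_mon :: var set \<Rightarrow> 'k::field sfpoly)"
proof (rule injI)
  fix A B
  assume "sf_mon A = (sf_mon B :: 'k sfpoly)"
  then have "sf_mon A A = (sf_mon B A :: 'k)" by simp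
  then show "A = B" by (simp add: sf_mon_def split: if_splits)
qed

lemma independent_sf_mon: "sf.independent (sf_mon ` \<A> :: 'k::field sfpoly set)"
  unfolding sf.dependent_def
proof (clarify)
  fix M assume "M \<in> \<A>" "(sf_mon M :: 'k sfpoly) \<in> sf.span (sf_mon ` \<A> - {sf_mon M})"
  moreover have "sf_mon ` \<A> - {sf_mon M} = (sf_mon ` (\<A> - {M}) :: 'k sfpoly set)"
    using injD[OF inj_sf_mon] by blast
  ultimately show False
    using span_sf_mon_support[of "sf_mon M" "\<A> - {M}" M] by (simp add: sf_mon_def)
qed

theorem theorem4p5:
  fixes m lam l :: nat
  assumes "finite (UNIV :: 'k::field set)" and "CHAR('k) = 2"
    and "m \<ge> 1" and "lam \<le> 2 * m"
    and "lam - m \<le> l" and "l \<le> lam div 2"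
  shows "int (sf_dim (S_space m lam l :: 'k sfpoly set))
           = binomz (2 * m) (int lam) - binomz (2 * m) (int lam - 2 * int l - 2)"
proof -
  let ?P = "P_set m lam l :: 'k sfpoly set"
  let ?mons = "{M. M \<subseteq> vars m \<and> card M = lam}"
  let ?D = "sf_mon ` ?mons :: 'k sfpoly set"
  let ?C = "sf_mon ` overfull_monomials m lam l :: 'k sfpoly set"
  \<comment> \<open>Truncated subtraction encodes the maximum with 0 in the lower bound on
    \<open>l\<close>.\<close>
  have le: "lam \<le> m + l" using assms(5) by simp
  have fin: "finite ?mons" by (rule finite_subset[of _ "Pow (vars m)"]) auto
  have sub: "overfull_monomials m lam l \<subseteq> ?mons"
    by (auto simp: overfull_monomials_def)
  have "sf.dim ?P + card ?C = card ?D"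
  proof (rule sf.dim_complement)
    show "?P \<subseteq> sf.span ?D"
    proof
      fix g assume "g \<in> ?P"
      then obtain rs S T U z where cd: "class_data m rs S T U"
        "2 * length rs + 2 * card S + card T = lam" and g: "g = ind (fam rs S T z)"
        unfolding mem_P_set_iff by blast
      have "fam rs S T z \<subseteq> ?mons" using fam_member[OF cd(1)] cd(2) by auto
      then show "g \<in> sf.span ?D"
        unfolding g
        by (intro ind_in_span finite_subset[OF _ fin] sf.span_base imageI) auto
    qed
    show "?D \<subseteq> sf.span (?P \<union> ?C)"
    proof clarify
      fix M assume "M \<subseteq> vars m" "lam = card M"
      then show "sf_mon M \<in> sf.span (P_set m (card M) l \<union> sf_mon ` overfull_monomials m (card M) l
          :: 'k sfpoly set)"
        using le by (intro sf_mon_in_span_P_set_overfull) auto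
    qed
    show "sf.span ?P \<inter> sf.span ?C \<subseteq> {0}"
    proof
      \<comment> \<open>\<open>f\<close> is supported on overfull monomials and killed by all
        pairings of degree at most \<open>lam - 2 * l - 2\<close>, so it vanishes.\<close>
      fix f assume f: "f \<in> sf.span ?P \<inter> sf.span ?C"
      have supp: "M \<in> overfull_monomials m lam l" if "f M \<noteq> 0" for M
        using f that span_sf_mon_support by blast
      have "f M = 0" for M
      proof (cases "M \<subseteq> vars m")
        case True
        show ?thesis
        proof (rule eq_zero_if_pairing_zero_overfull[where k = "int lam" and l = l and n = m])
          show "\<And>N. N \<subseteq> vars m \<Longrightarrow> int (card N) \<le> int lam - 2 * int l - 2 \<Longrightarrow> pairing m N f = 0"
            using f by (intro pairing_span_P_set_eq_zero[OF assms(2)]) auto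
        qed (use supp True le in \<open>auto simp: overfull_monomials_def\<close>)
      next
        case False
        then show ?thesis using supp by (auto simp: overfull_monomials_def)
      qed
      then show "f \<in> {0}" by (auto simp: fun_eq_iff)
    qed
  qed (use fin sub independent_sf_mon in auto)
  moreover have "card ?C = card (overfull_monomials m lam l)" "card ?D = card ?mons"
    by (simp_all add: card_image inj_on_subset[OF inj_sf_mon])
  moreover have "int (card ?mons) = binomz (2 * m) (int lam)"
    using card_subsets_vars[of m "int lam"] by simp
  moreover have "int (card (overfull_monomials m lam l)) = binomz (2 * m) (int lam - 2 * int l - 2)"
    using card_overfull[of "int lam" m l] le by (simp add: overfull_monomials_def)
  ultimately show ?thesis
    unfolding sf_dim_def S_space_def sf.dim_span by linarith
qed

end
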